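(* For every integer $n\geq 1$, let \[ V_{n}(x):=\frac{2(n+1)}{\binom{2n}{n}x^{n}(1-2x)}\left(Q_{n}(-x)^2-Q_{n-1}(-x)Q_{n+1}(-x)\right), \] which is a polynomial of degree $n-1$, and write $V_n(x)=\sum_{k=0}^{n-1}a_{k,n}x^k$. Then $V_n(x)$ is unimodal; more precisely, for $n\geq 2$, \[ a_{0,n}<a_{1,n}<\cdots<a_{n-3,n}<a_{n-2,n}>a_{n-1,n}. \]
   Context: For each integer $m\geq 0$, $P_m(x),Q_m(x)\in\mathbb{Q}[x]$ denote the unique pair of polynomials with $\deg P_m\leq m$, $\deg Q_m\leq m$ satisfying $P_m(x)x^{m+1}+Q_m(x)(x+1)^{m+1}=1$. A polynomial $\sum_{i=0}^N a_ix^i$ is unimodal if there is $0\leq m\leq N$ with $a_0\leq a_1\leq\cdots\leq a_m\geq a_{m+1}\geq\cdots\geq a_N$. *)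

theory Defs
  imports
    "HOL-Computational_Algebra.Computational_Algebra"
    "HOL-Computational_Algebra.Field_as_Ring"
begin

definition is_PQ :: "nat \<Rightarrow> rat poly \<times> rat poly \<Rightarrow> bool" where
  "is_PQ m = (\<lambda>(P, Q). degree P \<le> m \<and> degree Q \<le> m \<and>
      P * [:0, 1:] ^ (m + 1) + Q * [:1, 1:] ^ (m + 1) = 1)"

lemma is_PQ_ex1: "\<exists>!R. is_PQ m R"
proof -
  define A :: "rat poly" where "A = [:0, 1:] ^ (m + 1)"
  define B :: "rat poly" where "B = [:1, 1:] ^ (m + 1)"
  have dA: "degree A = m + 1" and dB: "degree B = m + 1"
    unfolding A_def B_def by (subst degree_power_eq; simp)+
  have A0: "A \<noteq> 0" and B0: "B \<noteq> 0"
    using dA dB by auto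
  have "coprime [:0, 1:] ([:1, 1:] :: rat poly)"
  proof (rule coprimeI)
    fix c :: "rat poly"
    assume "c dvd [:0, 1:]" and "c dvd [:1, 1:]"
    then have "c dvd [:1, 1:] - [:0, 1:]"
      by (intro dvd_diff)
    then show "is_unit c"
      by (simp add: one_pCons)
  qed
  then have cop: "coprime A B"
    unfolding A_def B_def by (simp only: coprime_power_left_iff coprime_power_right_iff) simp
  have iff: "is_PQ m (P, Q) \<longleftrightarrow> degree P \<le> m \<and> degree Q \<le> m \<and> P * A + Q * B = 1" for P Q
    by (simp only: is_PQ_def prod.case A_def B_def)
  obtain u v where uv: "u * A + v * B = 1"
    using bezout_coefficients_fst_snd[of A B] cop by auto
  define Q where "Q = v mod A"
  define P where "P = u + (v div A) * B"
  have "P * A + Q * B = u * A + (v div A * A + v mod A) * B"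
    unfolding P_def Q_def by (simp only: algebra_simps)
  also have "\<dots> = 1"
    using uv by (simp only: div_mult_mod_eq)
  finally have PQ: "P * A + Q * B = 1" .
  have dQ: "degree Q \<le> m"
    using degree_mod_less'[OF A0, of v] dA unfolding Q_def by (cases "v mod A = 0") auto
  have dP: "degree P \<le> m"
  proof (cases "P = 0")
    case False
    have "P * A = 1 - Q * B"
      using PQ by (simp add: algebra_simps)
    moreover have "degree (Q * B) \<le> m + (m + 1)"
      using degree_mult_le[of Q B] dQ dB by linarith
    ultimately have "degree (P * A) \<le> m + (m + 1)"
      using degree_diff_le[of 1 "m + (m + 1)" "Q * B"] by simp
    then show ?thesis
      using False A0 dA by (simp add: degree_mult_eq)
  qed simp
  show ?thesis
  proof (rule ex1I[of _ "(P, Q)"])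
    show "is_PQ m (P, Q)"
      using PQ dP dQ iff by blast
    fix R assume R: "is_PQ m R"
    obtain P' Q' where R_eq: "R = (P', Q')"
      by (cases R)
    then have *: "degree P' \<le> m" "degree Q' \<le> m" "P' * A + Q' * B = 1"
      using R iff by blast+
    have eq: "(P' - P) * A = (Q - Q') * B"
      using *(3) PQ by (simp add: algebra_simps)
    then have "A dvd (Q - Q') * B"
      by (metis dvd_triv_right)
    then have "A dvd Q - Q'"
      using cop by (simp add: coprime_dvd_mult_left_iff)
    moreover have "degree (Q - Q') \<le> m"
      using dQ *(2) by (rule degree_diff_le)
    ultimately have "Q - Q' = 0"
      using dvd_imp_degree_le[of A "Q - Q'"] dA by fastforce
    moreover from this have "P' - P = 0"
      using eq A0 by simp
    ultimately show "R = (P, Q)"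
      using R_eq by simp
  qed
qed

definition PQ :: "nat \<Rightarrow> rat poly \<times> rat poly" where
  "PQ m = (THE R. is_PQ m R)"

definition P_poly :: "nat \<Rightarrow> rat poly" where
  "P_poly m = fst (PQ m)"

definition Q_poly :: "nat \<Rightarrow> rat poly" where
  "Q_poly m = snd (PQ m)"

definition Q_neg :: "nat \<Rightarrow> rat poly" where
  "Q_neg m = pcompose (Q_poly m) [:0, -1:]"

text \<open>The expression defining \<open>V\<^sub>n\<close> is read in the field \<open>\<rat>(x)\<close> of rational functions;
  that it lies in \<open>\<rat>[x]\<close> is part of what is to be proved.\<close>

definition V_fract :: "nat \<Rightarrow> rat poly fract" where
  "V_fract n = to_fract [:of_nat (2 * (n + 1)):]
       / to_fract ([:of_nat ((2 * n) choose n):] * [:0, 1:] ^ n * [:1, -2:])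
       * to_fract (Q_neg n ^ 2 - Q_neg (n - 1) * Q_neg (n + 1))"

definition unimodal :: "'a::{zero, ord} poly \<Rightarrow> bool" where
  "unimodal p \<longleftrightarrow> (\<exists>m\<le>degree p.
      (\<forall>i<m. coeff p i \<le> coeff p (i + 1)) \<and>
      (\<forall>i. m \<le> i \<and> i < degree p \<longrightarrow> coeff p (i + 1) \<le> coeff p i))"

end

theory Submission
  imports Defs
begin

text \<open>
  The polynomial \<open>q\<^sub>n = Q\<^sub>n(-x)\<close> is the truncation \<open>\<Sum>k\<le>n. C(n+k,k) x\<^sup>k\<close> of \<open>(1-x)\<^sup>-\<^sup>n\<^sup>-\<^sup>1\<close>. Pascal's
  rule gives \<open>(1-x) q\<^sub>n = q\<^sub>n\<^sub>-\<^sub>1 + c\<^sub>n x\<^sup>n (1-2x)\<close> with \<open>c\<^sub>n = C(2n-1,n)\<close>. Using this recurrence to eliminate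
  \<open>q\<^sub>n\<^sub>+\<^sub>1\<close> from \<open>(1-x)(q\<^sub>n\<^sup>2 - q\<^sub>n\<^sub>-\<^sub>1 q\<^sub>n\<^sub>+\<^sub>1)\<close> leads to
  \<open>(1-x) V\<^sub>n = (n+1) q\<^sub>n - 2(2n+1) x q\<^sub>n\<^sub>-\<^sub>1\<close>. Hence the difference of the \<open>k\<close>-th and \<open>(k-1)\<close>-st coefficients of
  \<open>V\<^sub>n\<close> is a positive multiple of \<open>(n+1)(n+k)(n+k-1) - 2(2n+1)nk\<close>, which is positive for
  \<open>k \<le> n-2\<close> and negative for \<open>k = n-1, n\<close>.
\<close>

section \<open>Truncated negative powers of 1-x, and \<open>Q_neg\<close> as one of them\<close>

definition trunc_binom :: "nat \<Rightarrow> nat \<Rightarrow> rat poly" where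
  "trunc_binom a m = (\<Sum>k\<le>m. monom (of_nat ((a + k) choose k)) k)"

lemma coeff_trunc_binom:
  "coeff (trunc_binom a m) k = (if k \<le> m then of_nat ((a + k) choose k) else 0)"
  by (simp add: trunc_binom_def coeff_sum)

lemma degree_trunc_binom_le: "degree (trunc_binom a m) \<le> m"
  by (rule degree_le) (simp add: coeff_trunc_binom)

lemma coeff_one_minus_X_mult:
  fixes p :: "'a::comm_ring_1 poly"
  shows "coeff ([:1, -1:] * p) k = coeff p k - (case k of 0 \<Rightarrow> 0 | Suc j \<Rightarrow> coeff p j)"
  by (simp add: coeff_pCons split: nat.splits)

lemma one_minus_X_mult_trunc_binom_0:
  "[:1, -1:] * trunc_binom 0 m = 1 - monom 1 (Suc m)"
  by (rule poly_eqI)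
    (auto simp: coeff_pCons coeff_trunc_binom coeff_1 split: nat.splits)

text \<open>Pascal's rule gives the coefficients up to degree \<open>m\<close>; the monomial is what
  spills over the cut into degree \<open>Suc m\<close>.\<close>

lemma one_minus_X_mult_trunc_binom_Suc:
  "[:1, -1:] * trunc_binom (Suc a) m =
     trunc_binom a m - monom (of_nat ((Suc a + m) choose m)) (Suc m)"
  by (rule poly_eqI)
    (auto simp: coeff_pCons coeff_trunc_binom split: nat.splits)

text \<open>Each factor 1-x lowers \<open>a\<close> by one, up to a multiple of x^(m+1). The cut
  \<open>m\<close> stays fixed in this induction, which is why \<open>trunc_binom\<close> has two
  parameters.\<close>

lemma X_power_dvd_trunc_binom:
  "[:0, 1:] ^ Suc m dvd 1 - trunc_binom a m * [:1, -1:] ^ Suc a"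
proof (induction a)
  case 0
  have "1 - trunc_binom 0 m * [:1, -1:] ^ Suc 0 = monom 1 (Suc m)"
    using one_minus_X_mult_trunc_binom_0[of m]
    by (simp only: power_one_right mult.commute) simp
  then show ?case
    by (simp only: monom_altdef) simp
next
  case (Suc a)
  have "1 - trunc_binom (Suc a) m * [:1, -1:] ^ Suc (Suc a) =
      1 - ([:1, -1:] * trunc_binom (Suc a) m) * [:1, -1:] ^ Suc a"
    by (simp only: power_Suc mult_ac)
  also have "\<dots> = (1 - trunc_binom a m * [:1, -1:] ^ Suc a)
      + monom (of_nat ((Suc a + m) choose m)) (Suc m) * [:1, -1:] ^ Suc a"
    unfolding one_minus_X_mult_trunc_binom_Suc by (simp only: algebra_simps)
  finally show ?case
    using Suc by (auto simp only: monom_altdef intro!: dvd_add dvd_mult2 dvd_smult dvd_refl)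
qed

lemma pcompose_power: "pcompose (p ^ k) q = pcompose p q ^ k"
  for p q :: "'a::comm_semiring_1 poly"
  by (induction k) (simp_all add: pcompose_1 pcompose_mult)

text \<open>Both sides invert (1-x)^(m+1) modulo x^(m+1) and have degree at most \<open>m\<close>,
  so they coincide.\<close>

lemma Q_neg_eq: "Q_neg m = trunc_binom m m"
proof -
  define X :: "rat poly" where "X = [:0, 1:] ^ Suc m"
  define Y :: "rat poly" where "Y = [:1, -1:] ^ Suc m"
  have "is_PQ m (PQ m)"
    unfolding PQ_def by (rule theI'[OF is_PQ_ex1])
  then have deg: "degree (Q_poly m) \<le> m"
    and eq: "P_poly m * [:0, 1:] ^ (m + 1) + Q_poly m * [:1, 1:] ^ (m + 1) = 1"
    by (auto simp: is_PQ_def P_poly_def Q_poly_def split: prod.splits)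
  \<comment> \<open>Substituting -x for x in the defining identity turns x+1 into 1-x.\<close>
  have "pcompose (P_poly m) [:0, -1:] * [:0, -1:] ^ Suc m + Q_neg m * Y = 1"
    using arg_cong[OF eq, of "\<lambda>p. pcompose p [:0, -1:]"]
    by (simp only: pcompose_add pcompose_mult pcompose_power pcompose_1 Q_neg_def Y_def)
      (simp add: pcompose_pCons)
  moreover have "[:0, -1:] ^ Suc m = (-1) ^ Suc m * X"
    unfolding X_def power_mult_distrib[symmetric] by simp
  ultimately have "1 - Q_neg m * Y = pcompose (P_poly m) [:0, -1:] * (-1) ^ Suc m * X"
    by (metis add_diff_cancel_right' mult.assoc)
  then have "X dvd 1 - Q_neg m * Y"
    by (simp only: dvd_triv_right)
  moreover have "X dvd 1 - trunc_binom m m * Y"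
    unfolding X_def Y_def by (rule X_power_dvd_trunc_binom)
  ultimately have "X dvd (1 - trunc_binom m m * Y) - (1 - Q_neg m * Y)"
    by (rule dvd_diff[rotated])
  then have "X dvd (Q_neg m - trunc_binom m m) * Y"
    by (simp add: algebra_simps)
  moreover have "coprime X Y"
  proof -
    have "coprime [:0, 1:] ([:1, -1:] :: rat poly)"
    proof (rule coprimeI)
      fix c :: "rat poly"
      assume "c dvd [:0, 1:]" and "c dvd [:1, -1:]"
      then have "c dvd [:1, -1:] + [:0, 1:]"
        by (intro dvd_add)
      then show "is_unit c"
        by (simp add: one_pCons)
    qed
    then show ?thesis
      unfolding X_def Y_def by (simp only: coprime_power_left_iff coprime_power_right_iff) simp
  qed
  ultimately have "X dvd Q_neg m - trunc_binom m m"
    by (simp add: coprime_dvd_mult_left_iff)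
  moreover have "degree (Q_neg m - trunc_binom m m) \<le> m"
    using deg by (intro degree_diff_le degree_trunc_binom_le) (simp add: Q_neg_def degree_pcompose)
  moreover have "degree X = Suc m"
    unfolding X_def by (subst degree_power_eq) auto
  ultimately have "Q_neg m - trunc_binom m m = 0"
    using dvd_imp_degree_le[of X "Q_neg m - trunc_binom m m"] by fastforce
  then show ?thesis
    by simp
qed

section \<open>The diagonal recurrence and the binomial identities\<close>

lemma central_binomial_Suc: "(2 * Suc r) choose (Suc r) = 2 * (Suc (2 * r) choose Suc r)"
proof -
  have "(2 * Suc r) choose (Suc r) = (Suc (2 * r) choose r) + (Suc (2 * r) choose Suc r)"
    by simp
  also have "Suc (2 * r) choose r = Suc (2 * r) choose Suc r"
    by (subst binomial_symmetric) (auto intro: arg_cong)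
  finally show ?thesis by simp
qed

text \<open>The top term of \<open>trunc_binom r (Suc r)\<close> and the spill-over have
  coefficients c and -2c, by \<open>central_binomial_Suc\<close>; this produces the factor
  1-2x.\<close>

lemma trunc_binom_diagonal_recurrence:
  "[:1, -1:] * trunc_binom (Suc r) (Suc r) = trunc_binom r r +
     [:of_nat (Suc (2 * r) choose Suc r):] * [:0, 1:] ^ Suc r * [:1, -2:]"
proof -
  have "[:1, -1:] * trunc_binom (Suc r) (Suc r) = trunc_binom r (Suc r)
      - monom (of_nat ((2 * Suc r) choose Suc r)) (Suc (Suc r))"
    by (simp only: one_minus_X_mult_trunc_binom_Suc mult_2)
  also have "trunc_binom r (Suc r) =
      trunc_binom r r + monom (of_nat (Suc (2 * r) choose Suc r)) (Suc r)"
    by (simp add: trunc_binom_def mult_2)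
  finally have rec: "[:1, -1:] * trunc_binom (Suc r) (Suc r) =
      trunc_binom r r + (monom (of_nat (Suc (2 * r) choose Suc r)) (Suc r)
        - monom (2 * of_nat (Suc (2 * r) choose Suc r)) (Suc (Suc r)))"
    by (simp only: central_binomial_Suc of_nat_mult of_nat_numeral add_diff_eq)
  have monoms: "monom c k - monom (2 * c) (Suc k) = [:c:] * [:0, 1:] ^ k * [:1, -2:]"
    for c :: rat and k
  proof -
    have "monom c k - monom (2 * c) (Suc k) = [:1, -2:] * monom c k"
      by (rule poly_eqI) (auto simp: coeff_pCons split: nat.splits)
    then show ?thesis
      by (simp add: monom_altdef mult.commute)
  qed
  show ?thesis
    unfolding rec monoms ..
qed

text \<open>Relates the constants of two consecutive instances of the recurrence, so that they share
  a common factor in \<open>V_diff_eq\<close>.\<close>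

lemma central_binomial_ratio:
  "(r + 2) * (Suc (2 * Suc r) choose Suc (Suc r)) = 2 * (2 * r + 3) * (Suc (2 * r) choose Suc r)"
proof -
  have "(r + 2) * (Suc (2 * Suc r) choose Suc (Suc r)) = Suc (2 * Suc r) * ((2 * Suc r) choose Suc r)"
    using Suc_times_binomial[of "Suc r" "2 * Suc r"] by (simp only: add_2_eq_Suc')
  also have "\<dots> = Suc (2 * Suc r) * (2 * (Suc (2 * r) choose Suc r))"
    by (simp only: central_binomial_Suc)
  also have "\<dots> = 2 * (2 * r + 3) * (Suc (2 * r) choose Suc r)"
  proof -
    have "Suc (2 * Suc r) = 2 * r + 3"
      by simp
    then show ?thesis
      by (simp only: mult_ac)
  qed
  finally show ?thesis .
qed

text \<open>Two absorption steps; they reduce both binomials in a coefficient of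
  \<open>V_diff\<close> to the same one.\<close>

lemma binomial_step_two:
  "Suc r * Suc j * (Suc (Suc (r + j)) choose Suc j) =
     Suc (Suc (r + j)) * Suc (r + j) * ((r + j) choose j)"
proof -
  have "Suc j * (Suc (Suc (r + j)) choose Suc j) = Suc (Suc (r + j)) * (Suc (r + j) choose j)"
    by (rule Suc_times_binomial)
  moreover have "Suc r * (Suc (r + j) choose j) = Suc (r + j) * ((r + j) choose j)"
    using Suc_times_binomial[of r "r + j"] binomial_symmetric[of j "Suc (r + j)"]
      binomial_symmetric[of j "r + j"] by simp
  ultimately show ?thesis
    by (metis mult.assoc mult.left_commute)
qed

text \<open>This is \<open>(1-x) V\<^sub>n\<close> with the index shifted to \<open>n = r + 1\<close>.\<close>

definition V_diff :: "nat \<Rightarrow> rat poly" where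
  "V_diff r = [:of_nat (r + 2):] * trunc_binom (Suc r) (Suc r)
     - [:of_nat (2 * (2 * r + 3)):] * [:0, 1:] * trunc_binom r r"

lemma V_diff_eq:
  "[:1, -1:] * ([:of_nat (2 * (r + 2)):] * (trunc_binom (Suc r) (Suc r) ^ 2
       - trunc_binom r r * trunc_binom (Suc (Suc r)) (Suc (Suc r)))) =
     V_diff r * ([:of_nat ((2 * Suc r) choose Suc r):] * [:0, 1:] ^ Suc r * [:1, -2:])"
proof -
  define Y X Z :: "rat poly" where "Y = [:1, -1:]" and "X = [:0, 1:]" and "Z = X ^ Suc r * [:1, -2:]"
  define p q s where "p = trunc_binom r r" and "q = trunc_binom (Suc r) (Suc r)"
    and "s = trunc_binom (Suc (Suc r)) (Suc (Suc r))"
  define c d m l :: "rat poly" where "c = of_nat (Suc (2 * r) choose Suc r)"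
    and "d = of_nat (Suc (2 * Suc r) choose Suc (Suc r))"
    and "m = of_nat (r + 2)" and "l = of_nat (2 * (2 * r + 3))"
  have q: "Y * q = p + c * Z"
    using trunc_binom_diagonal_recurrence[of r]
    by (simp only: Y_def q_def p_def c_def Z_def X_def of_nat_poly mult.assoc)
  have s: "Y * s = q + d * (X * Z)"
    using trunc_binom_diagonal_recurrence[of "Suc r"]
    by (simp only: Y_def q_def s_def d_def Z_def X_def of_nat_poly mult.assoc power_Suc)
  have md: "m * d = l * c"
    using arg_cong[OF central_binomial_ratio[of r], of "of_nat :: nat \<Rightarrow> rat poly"]
    unfolding m_def d_def l_def c_def by (simp only: of_nat_mult)
  have "Y * (m * (q ^ 2 - p * s)) = m * (q * (Y * q) - p * (Y * s))"
    by (simp add: algebra_simps power2_eq_square)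
  \<comment> \<open>Both recurrences contribute \<open>p * q\<close>, which cancels.\<close>
  also have "\<dots> = m * c * q * Z - m * d * X * p * Z"
    unfolding q s by (simp add: algebra_simps)
  also have "\<dots> = (m * q - l * X * p) * (c * Z)"
    unfolding md by (simp add: algebra_simps)
  finally have "Y * (2 * m * (q ^ 2 - p * s)) = (m * q - l * X * p) * (2 * c * Z)"
    by (simp add: algebra_simps)
  moreover have "[:of_nat (2 * (r + 2)):] = 2 * m"
    and "[:of_nat ((2 * Suc r) choose Suc r):] = 2 * c"
    and "[:of_nat (r + 2):] = m" and "[:of_nat (2 * (2 * r + 3)):] = l"
    unfolding central_binomial_Suc m_def c_def l_def
    by (simp_all add: of_nat_poly numeral_poly del: binomial_Suc_Suc)
  ultimately show ?thesis
    by (simp only: V_diff_def Y_def X_def Z_def p_def q_def s_def mult.assoc)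
qed

section \<open>Signs of the coefficients of \<open>V_diff\<close>\<close>

lemma coeff_V_diff_0: "coeff (V_diff r) 0 = of_nat (r + 2)"
  by (simp add: V_diff_def coeff_trunc_binom)

text \<open>The factor \<open>Suc r * Suc j\<close> clears denominators, so the sign rests on the
  integer bracket alone. For \<open>j \<le> r\<close> neither truncation has cut off the terms
  involved.\<close>

lemma coeff_V_diff_Suc:
  assumes "j \<le> r"
  shows "of_nat (Suc r * Suc j) * coeff (V_diff r) (Suc j) = of_nat ((r + j) choose j) *
    (of_nat ((r + 2) * (r + j + 2) * (r + j + 1)) - of_nat (2 * (2 * r + 3) * (r + 1) * (j + 1)))"
proof -
  have c: "coeff (V_diff r) (Suc j) = of_nat (r + 2) * of_nat (Suc (Suc (r + j)) choose Suc j)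
      - of_nat (2 * (2 * r + 3)) * of_nat ((r + j) choose j)"
    using assms by (simp add: V_diff_def coeff_trunc_binom del: binomial_Suc_Suc)
  have b: "of_nat (Suc r * Suc j) * of_nat (Suc (Suc (r + j)) choose Suc j) =
      (of_nat ((r + j + 2) * (r + j + 1)) * of_nat ((r + j) choose j) :: rat)"
    using arg_cong[OF binomial_step_two[of r j], of "of_nat :: nat \<Rightarrow> rat"]
    by (simp only: of_nat_mult) simp
  have "of_nat (Suc r * Suc j) * coeff (V_diff r) (Suc j) =
      of_nat (r + 2) * (of_nat (Suc r * Suc j) * of_nat (Suc (Suc (r + j)) choose Suc j))
      - of_nat (Suc r * Suc j) * of_nat (2 * (2 * r + 3)) * of_nat ((r + j) choose j)"
    unfolding c by (simp only: algebra_simps)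
  also have "\<dots> = of_nat ((r + j) choose j) *
    (of_nat ((r + 2) * (r + j + 2) * (r + j + 1)) - of_nat (2 * (2 * r + 3) * (r + 1) * (j + 1)))"
    unfolding b by (simp add: algebra_simps)
  finally show ?thesis .
qed

lemma coeff_V_diff_pos:
  assumes "k < r"
  shows "coeff (V_diff r) k > 0"
proof (cases k)
  case 0
  then show ?thesis
    by (simp add: coeff_V_diff_0)
next
  case (Suc j)
  then obtain i where r: "r = Suc (Suc j) + i"
    using assms le_Suc_ex[of "Suc (Suc j)" r] by auto
  \<comment> \<open>In terms of the slack \<open>i = r - j - 2\<close> the bracket has only positive
    coefficients.\<close>
  have "(r + 2) * (r + j + 2) * (r + j + 1) =
      2 * (2 * r + 3) * (r + 1) * (j + 1) + (6 + i * (3 * r + 8) + (r + 2) * i ^ 2)"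
    unfolding r by (simp add: algebra_simps power2_eq_square)
  then have "of_nat ((r + 2) * (r + j + 2) * (r + j + 1)) -
      of_nat (2 * (2 * r + 3) * (r + 1) * (j + 1)) =
      (of_nat (6 + i * (3 * r + 8) + (r + 2) * i ^ 2) :: rat)"
    by (simp only: of_nat_add add_diff_cancel_left')
  moreover have "j \<le> r"
    using r by simp
  ultimately have "of_nat (Suc r * Suc j) * coeff (V_diff r) (Suc j) =
      of_nat ((r + j) choose j) * of_nat (6 + i * (3 * r + 8) + (r + 2) * i ^ 2)"
    using coeff_V_diff_Suc[of j r] by (simp only:)
  also have "\<dots> > 0"
    by (intro mult_pos_pos; subst of_nat_0_less_iff) simp_all
  finally show ?thesis
    unfolding Suc by (rule zero_less_mult_pos) (subst of_nat_0_less_iff, simp)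
qed

lemma coeff_V_diff_neg:
  assumes "k = r \<and> r \<ge> 1 \<or> k = Suc r"
  shows "coeff (V_diff r) k < 0"
proof -
  obtain j where j: "k = Suc j" "j = r \<or> r = Suc j"
    using assms by (cases k) auto
  \<comment> \<open>In both cases the bracket is exactly \<open>- 2 * (j + 1)\<close>.\<close>
  have "2 * (2 * r + 3) * (r + 1) * (j + 1) = (r + 2) * (r + j + 2) * (r + j + 1) + 2 * (j + 1)"
    using j(2) by (elim disjE) (simp_all add: algebra_simps)
  then have "of_nat ((r + 2) * (r + j + 2) * (r + j + 1)) -
      of_nat (2 * (2 * r + 3) * (r + 1) * (j + 1)) = (- of_nat (2 * (j + 1)) :: rat)"
    by (simp only: of_nat_add)
  moreover have "j \<le> r"
    using j(2) by auto
  ultimately have "of_nat (Suc r * Suc j) * coeff (V_diff r) (Suc j) =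
      of_nat ((r + j) choose j) * - of_nat (2 * (j + 1))"
    using coeff_V_diff_Suc[of j r] by (simp only:)
  also have "\<dots> < 0"
    by (intro mult_pos_neg; (subst neg_less_0_iff_less)?; subst of_nat_0_less_iff) simp_all
  finally have "\<not> 0 \<le> of_nat (Suc r * Suc j) * coeff (V_diff r) (Suc j)"
    by (simp only: not_le)
  then show ?thesis
    unfolding j(1) using mult_nonneg_nonneg[OF of_nat_0_le_iff] not_less by blast
qed

lemma degree_V_diff_le: "degree (V_diff r) \<le> Suc r"
  by (rule degree_le) (auto simp: V_diff_def coeff_trunc_binom coeff_pCons split: nat.splits)

section \<open>Polynomiality, degree and unimodality\<close>

theorem theorem7p6:
  fixes n :: nat
  assumes "n \<ge> 1"
  shows "\<exists>v :: rat poly. V_fract n = to_fract v \<and> v \<noteq> 0 \<and> degree v = n - 1 \<and> unimodal v \<and>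
    (n \<ge> 2 \<longrightarrow> (\<forall>k<n - 2. coeff v k < coeff v (k + 1)) \<and> coeff v (n - 2) > coeff v (n - 1))"
proof -
  obtain r where n: "n = Suc r"
    using assms by (cases n) auto
  define B D :: "rat poly"
    where "B = [:of_nat ((2 * Suc r) choose Suc r):] * [:0, 1:] ^ Suc r * [:1, -2:]"
      and "D = Q_neg (Suc r) ^ 2 - Q_neg r * Q_neg (Suc (Suc r))"
  have eq: "[:1, -1:] * ([:of_nat (2 * (r + 2)):] * D) = V_diff r * B"
    unfolding D_def B_def Q_neg_eq by (rule V_diff_eq)
  have B1: "poly B 1 \<noteq> 0"
    unfolding B_def by (simp del: binomial_Suc_Suc)
  \<comment> \<open>At x = 1 the left side of \<open>eq\<close> vanishes while \<open>B\<close> does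
    not, so 1-x divides \<open>V_diff r\<close>; the quotient is the required polynomial.\<close>
  have "poly (V_diff r) 1 * poly B 1 = 0"
    using arg_cong[OF eq, of "\<lambda>p. poly p 1"] by simp
  then have "poly (V_diff r) 1 = 0"
    using B1 by simp
  then obtain w where w: "V_diff r = [:-1, 1:] * w"
    by (auto simp: poly_eq_0_iff_dvd elim: dvdE)
  \<comment> \<open>The sign turns x-1 into 1-x, which makes the coefficients of
    \<open>V_diff r\<close> the consecutive differences of those of \<open>v\<close>.\<close>
  define v where "v = - w"
  have v: "V_diff r = [:1, -1:] * v"
    unfolding w v_def by simp
  have B0: "B \<noteq> 0"
    using B1 by auto
  have "[:1, -1:] * ([:of_nat (2 * (r + 2)):] * D) = [:1, -1:] * (v * B)"
    using eq unfolding v by (simp only: mult.assoc)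
  then have "[:of_nat (2 * (r + 2)):] * D = v * B"
    by (subst (asm) mult_left_cancel) simp_all
  then have "to_fract [:of_nat (2 * (r + 2)):] * to_fract D = to_fract v * to_fract B"
    by (simp only: to_fract_mult[symmetric])
  moreover have "V_fract n = to_fract [:of_nat (2 * (r + 2)):] / to_fract B * to_fract D"
  proof -
    have "n - 1 = r" "n + 1 = Suc (Suc r)" "r + 2 = Suc (Suc r)"
      using n by simp_all
    then show ?thesis
      unfolding V_fract_def B_def D_def by (simp only: n)
  qed
  ultimately have fract: "V_fract n = to_fract v"
    using B0 by simp
  have step: "coeff v (Suc k) - coeff v k = coeff (V_diff r) (Suc k)" for k
    unfolding v by (simp only: coeff_one_minus_X_mult) simp
  have v0: "v \<noteq> 0"
    using v coeff_V_diff_0[of r] by auto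
  have deg_le: "degree v \<le> r"
    using degree_V_diff_le[of r] v0 unfolding v by (subst (asm) degree_mult_eq) auto
  \<comment> \<open>The negative difference at \<open>Suc r\<close> ends at this zero, so the
    coefficient at \<open>r\<close> is positive and the degree is exactly \<open>r\<close>.\<close>
  then have "coeff v (Suc r) = 0"
    by (simp add: coeff_eq_0)
  then have "coeff v r > 0"
    using step[of r] coeff_V_diff_neg[of "Suc r" r] by simp
  then have deg: "degree v = r"
    using deg_le le_degree[of v r] by simp
  have inc: "coeff v k < coeff v (k + 1)" if "k < r - 1" for k
    using step[of k] coeff_V_diff_pos[of "Suc k" r] that by (simp add: less_diff_conv)
  have dec: "coeff v r < coeff v (r - 1)" if "r \<ge> 1"
    using step[of "r - 1"] coeff_V_diff_neg[of r r] that by simp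
  have "unimodal v"
    unfolding unimodal_def deg
  \<comment> \<open>The peak is at n-2; for \<open>r = 0\<close> truncated subtraction gives 0, the
    only index of a constant.\<close>
  proof (intro exI[of _ "r - 1"] conjI allI impI)
    fix i
    assume "r - 1 \<le> i \<and> i < r"
    then have "i = r - 1" "r \<ge> 1" by auto
    then show "coeff v (i + 1) \<le> coeff v i"
      using dec by simp
  qed (use inc in \<open>auto intro: less_imp_le\<close>)
  then show ?thesis
    using fract v0 deg inc dec by (intro exI[of _ v]) (auto simp: n)
qed

end
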